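(* If the weak $3x+1$ conjecture is true, then the wild semigroup $\mathcal{W}$ consists exactly of all positive rational numbers $a/b$ (in lowest terms, $a,b$ positive integers) with $\gcd(a,3b)=1$.
   Context: For integers $n\ge 0$ let $g(n)=\frac{3n+2}{2n+1}$. The wild semigroup $\mathcal{W}$ is the multiplicative semigroup of positive rationals generated by $\{g(n): n\ge 0\}$ together with $\frac12$ (all finite products, repetitions allowed). The weak $3x+1$ conjecture is the assertion that the semigroup $\mathcal{W}^{-1}=\{w^{-1}: w\in\mathcal{W}\}$ (generated by $\{\frac{2n+1}{3n+2}: n\ge 0\}$ together with $2$) contains every positive integer. *)

theory Defs
  imports Complex_Main
begin

inductive_set mult_semigroup :: "'a::semigroup_mult set \<Rightarrow> 'a set" for S where
  generator: "x \<in> S \<Longrightarrow> x \<in> mult_semigroup S"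
| product: "x \<in> mult_semigroup S \<Longrightarrow> y \<in> mult_semigroup S \<Longrightarrow> x * y \<in> mult_semigroup S"

definition wild_gen :: "nat \<Rightarrow> rat" where
  "wild_gen n = (3 * of_nat n + 2) / (2 * of_nat n + 1)"

definition wild_semigroup :: "rat set" where
  "wild_semigroup = mult_semigroup (range wild_gen \<union> {1/2})"

definition inverse_wild_semigroup :: "rat set" where
  "inverse_wild_semigroup = inverse ` wild_semigroup"

definition weak_3x_plus_1_conjecture :: bool where
  "weak_3x_plus_1_conjecture \<longleftrightarrow> (\<forall>n::nat. n > 0 \<longrightarrow> of_nat n \<in> inverse_wild_semigroup)"

end

theory Submission
  imports Defs "HOL-Number_Theory.Residues"
begin

text \<open>
  Under the conjecture, \<open>1/n\<close> lies in \<open>\<W>\<close> for every \<open>n > 0\<close>, so it suffices to put every prime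
  \<open>p \<noteq> 3\<close> into \<open>\<W>\<close>. Since \<open>g((N-1)/2) \<cdot> N = (3N+1)/2\<close>, an odd integer \<open>N \<in> \<W>\<close> puts every odd
  divisor of \<open>3N+1\<close> into \<open>\<W>\<close>. Hence, by induction, it suffices to find an odd product of integers
  smaller than \<open>p\<close> and prime to \<open>3\<close> that is congruent to \<open>-1/3\<close> modulo \<open>p\<close>. The residues of such
  products form a subgroup of the units modulo \<open>p\<close>. For \<open>p > 29\<close> it contains \<open>2\<close>, because one of five
  suitable numbers \<open>p + 2u\<close>, with \<open>u\<close> small and prime to \<open>6\<close>, has the form \<open>5s\<close> with \<open>s < p\<close> prime to
  \<open>6\<close>; it then contains \<open>-1\<close> and \<open>3\<close>, because small multiples of \<open>p\<close> lie next to suitable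
  integers. The primes up to \<open>29\<close> are handled by explicit factorizations.
\<close>

section \<open>Elementary members of the semigroup and the primes up to 29\<close>

lemma wild_semigroup_mult:
  "x \<in> wild_semigroup \<Longrightarrow> y \<in> wild_semigroup \<Longrightarrow> x * y \<in> wild_semigroup"
  unfolding wild_semigroup_def by (rule mult_semigroup.product)

lemma wild_gen_in_wild_semigroup: "wild_gen n \<in> wild_semigroup"
  unfolding wild_semigroup_def by (auto intro: mult_semigroup.generator)

lemma half_in_wild_semigroup: "1/2 \<in> wild_semigroup"
  unfolding wild_semigroup_def by (auto intro: mult_semigroup.generator)

lemma two_in_wild_semigroup: "2 \<in> wild_semigroup"
  using wild_gen_in_wild_semigroup[of 0] by (simp add: wild_gen_def)

lemma one_in_wild_semigroup: "1 \<in> wild_semigroup"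
  using wild_semigroup_mult[OF two_in_wild_semigroup half_in_wild_semigroup] by simp

lemma wild_semigroup_power: "x \<in> wild_semigroup \<Longrightarrow> x ^ n \<in> wild_semigroup"
  by (induction n) (auto intro: one_in_wild_semigroup wild_semigroup_mult)

lemma unit_fraction_in_wild_semigroup:
  assumes "weak_3x_plus_1_conjecture" "n > 0"
  shows "1 / of_nat n \<in> wild_semigroup"
proof -
  have "of_nat n \<in> inverse ` wild_semigroup"
    using assms unfolding weak_3x_plus_1_conjecture_def inverse_wild_semigroup_def by blast
  then obtain w where "w \<in> wild_semigroup" "of_nat n = inverse w" by blast
  then show ?thesis by (simp add: divide_inverse)
qed

text \<open>For \<open>N = 2 * m + 1\<close> the product of \<open>wild_gen m\<close> and
  \<open>N\<close> is \<open>3 * m + 2 = a * k\<close>; the conjecture supplies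
  \<open>1 / k\<close>, which removes the cofactor.\<close>

lemma in_wild_semigroup_if_mult_eq:
  assumes "weak_3x_plus_1_conjecture" "odd N" "of_nat N \<in> wild_semigroup" "2 * a * k = 3 * N + 1"
  shows "of_nat a \<in> wild_semigroup"
proof -
  obtain m where m: "N = 2 * m + 1" using assms(2) by (elim oddE)
  have "k > 0" using assms(4) by (cases k) auto
  have ak: "a * k = 3 * m + 2" using assms(4) m by simp
  have "of_nat a * of_nat k = (3 * of_nat m + 2 :: rat)"
    using arg_cong[OF ak, of "of_nat :: nat \<Rightarrow> rat"] by simp
  moreover have "(2 * of_nat m + 1 :: rat) \<noteq> 0"
    using of_nat_neq_0[of "2 * m", where 'a = rat] by (simp add: add.commute)
  ultimately have "of_nat a = wild_gen m * of_nat N * (1 / of_nat k)"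
    using \<open>k > 0\<close> by (simp add: wild_gen_def m add.commute eq_divide_eq)
  then show ?thesis
    using unit_fraction_in_wild_semigroup[OF assms(1) \<open>k > 0\<close>] assms(3)
    by (metis wild_semigroup_mult wild_gen_in_wild_semigroup)
qed

lemma in_wild_semigroup_if_dvd:
  assumes "weak_3x_plus_1_conjecture" "odd N" "of_nat N \<in> wild_semigroup" "odd a" "a dvd 3 * N + 1"
  shows "of_nat a \<in> wild_semigroup"
proof -
  have "2 dvd 3 * N + 1" using assms(2) by simp
  then have "2 * a dvd 3 * N + 1"
    using assms(4,5) by (simp add: divides_mult coprime_commute)
  then obtain k where "2 * a * k = 3 * N + 1" by (metis dvdE)
  then show ?thesis using in_wild_semigroup_if_mult_eq assms(1-3) by blast
qed

text \<open>
  Started from \<open>1\<close> and \<open>2\<close>, the previous lemma yields no further odd integer, so a base case is needed;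
  the product below was found by integer programming on the exponents of small primes.
\<close>

lemma seven_in_wild_semigroup: "7 \<in> wild_semigroup"
proof -
  have "7 = wild_gen 3 ^ 5 * wild_gen 5 ^ 5 * wild_gen 8 ^ 4 * wild_gen 32 ^ 4 * wild_gen 416
      * (1/2) ^ 9"
    by (simp add: wild_gen_def field_simps)
  also have "\<dots> \<in> wild_semigroup"
    by (intro wild_semigroup_mult wild_semigroup_power wild_gen_in_wild_semigroup
        half_in_wild_semigroup)
  finally show ?thesis .
qed

lemma small_primes_in_wild_semigroup:
  assumes conj: "weak_3x_plus_1_conjecture" and "prime p" "p \<noteq> 3" "p \<le> (29::nat)"
  shows "of_nat p \<in> wild_semigroup"
proof -
  note step = in_wild_semigroup_if_mult_eq[OF conj]
  have 7: "of_nat 7 \<in> wild_semigroup" using seven_in_wild_semigroup by simp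
  have 11: "of_nat 11 \<in> wild_semigroup" by (rule step[of 7 _ 1]) (use 7 in auto)
  have 17: "of_nat 17 \<in> wild_semigroup" by (rule step[of 11 _ 1]) (use 11 in auto)
  have 13: "of_nat 13 \<in> wild_semigroup" by (rule step[of 17 _ 2]) (use 17 in auto)
  have 5: "of_nat 5 \<in> wild_semigroup" by (rule step[of 13 _ 4]) (use 13 in auto)
  have 25: "of_nat 25 \<in> wild_semigroup" using wild_semigroup_mult[OF 5 5] by simp
  have 19: "of_nat 19 \<in> wild_semigroup" by (rule step[of 25 _ 2]) (use 25 in auto)
  \<comment> \<open>An odd \<open>N\<close> with 23 dividing \<open>3 * N + 1\<close> is 15 modulo
    46; the least such product of primes already reached is 245.\<close>
  have 245: "of_nat 245 \<in> wild_semigroup"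
    using wild_semigroup_mult[OF 5 wild_semigroup_mult[OF 7 7]] by simp
  have 23: "of_nat 23 \<in> wild_semigroup" by (rule step[of 245 _ 16]) (use 245 in auto)
  have 29: "of_nat 29 \<in> wild_semigroup" by (rule step[of 19 _ 1]) (use 19 in auto)
  \<comment> \<open>Sieving by 2, 3 and 5 leaves only primes, since 29 < 49.\<close>
  have "\<not> 2 dvd p \<or> p = 2" "\<not> 3 dvd p" "\<not> 5 dvd p \<or> p = 5"
    using primes_dvd_imp_eq[of 2 p] primes_dvd_imp_eq[of 3 p] primes_dvd_imp_eq[of 5 p] assms(2,3)
    by auto
  moreover have "p > 1" using assms(2) by (rule prime_gt_1_nat)
  moreover have "p \<in> {..29}" using assms(4) by simp
  ultimately have "p \<in> {2, 5, 7, 11, 13, 17, 19, 23, 29}"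
    by (auto simp: atMost_nat_numeral simp del: atMost_iff)
  then show ?thesis
    using two_in_wild_semigroup 5 7 11 13 17 19 23 29 by auto
qed

section \<open>Residues of odd members modulo a prime\<close>

text \<open>Oddness is asked of the representative \<open>N\<close>, because
  \<open>3 * N + 1\<close> must be even; the residue itself may be even or negative, such as 2 or
  -1.\<close>

definition odd_wild_residue :: "nat \<Rightarrow> int \<Rightarrow> bool" where
  "odd_wild_residue p x \<longleftrightarrow>
    (\<exists>N. odd N \<and> of_nat N \<in> wild_semigroup \<and> [int N = x] (mod int p))"

lemma odd_wild_residueI:
  "odd N \<Longrightarrow> of_nat N \<in> wild_semigroup \<Longrightarrow> odd_wild_residue p (int N)"
  unfolding odd_wild_residue_def by auto

lemma odd_wild_residue_cong:
  "odd_wild_residue p x \<Longrightarrow> [x = y] (mod int p) \<Longrightarrow> odd_wild_residue p y"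
  unfolding odd_wild_residue_def by (meson cong_trans)

lemma odd_wild_residue_mult:
  assumes "odd_wild_residue p x" "odd_wild_residue p y"
  shows "odd_wild_residue p (x * y)"
proof -
  obtain M N where "odd M" "of_nat M \<in> wild_semigroup" "[int M = x] (mod int p)"
      "odd N" "of_nat N \<in> wild_semigroup" "[int N = y] (mod int p)"
    using assms unfolding odd_wild_residue_def by blast
  then have "odd (M * N)" "of_nat (M * N) \<in> wild_semigroup" "[int (M * N) = x * y] (mod int p)"
    by (auto intro: wild_semigroup_mult cong_mult)
  then show ?thesis unfolding odd_wild_residue_def by blast
qed

lemma odd_wild_residue_power: "odd_wild_residue p x \<Longrightarrow> odd_wild_residue p (x ^ n)"
proof (induction n)
  case 0
  show ?case using odd_wild_residueI[of 1 p] one_in_wild_semigroup by simp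
qed (auto intro: odd_wild_residue_mult)

text \<open>By Fermat, the power \<open>x ^ (p - 2)\<close> inverts \<open>x\<close>, so closure
  under products already gives division.\<close>

lemma odd_wild_residue_cancel:
  assumes "prime p" "\<not> int p dvd x" "odd_wild_residue p x" "odd_wild_residue p (x * y)"
  shows "odd_wild_residue p y"
proof -
  have p: "p - 1 = Suc (p - 2)" using prime_gt_1_nat[OF assms(1)] by simp
  have "[x ^ (p - 1) = 1] (mod int p)"
    using residues.euler_theorem[of "int p" x] prime_imp_coprime[of "int p" x] assms(1,2)
      prime_gt_1_nat[OF assms(1)]
    by (simp add: residues_def totient_prime coprime_commute)
  then have "[x ^ (p - 1) * y = 1 * y] (mod int p)" by (rule cong_scalar_right)
  moreover have "x ^ (p - 1) * y = x ^ (p - 2) * (x * y)" by (simp only: p power_Suc ac_simps)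
  ultimately have "[x ^ (p - 2) * (x * y) = y] (mod int p)" by (simp only: mult_1)
  moreover have "odd_wild_residue p (x ^ (p - 2) * (x * y))"
    using odd_wild_residue_power[OF assms(3)] assms(4) by (rule odd_wild_residue_mult)
  ultimately show ?thesis by (rule odd_wild_residue_cong[rotated])
qed

text \<open>An odd representative \<open>N\<close> of such a \<open>w\<close> has \<open>p\<close>
  dividing \<open>3 * N + 1\<close>, which is what puts \<open>p\<close> into the semigroup.\<close>

lemma odd_wild_residue_minus_third:
  assumes p: "prime p" "p > 29"
    and IH: "\<And>m. 0 < m \<Longrightarrow> m < p \<Longrightarrow> \<not> 3 dvd m \<Longrightarrow> of_nat m \<in> wild_semigroup"
  shows "\<exists>w. odd_wild_residue p w \<and> int p dvd 3 * w + 1"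
proof -
  let ?H = "odd_wild_residue p"
  note cancel = odd_wild_residue_cancel[OF p(1)]
  have not_dvd: "\<not> int p dvd int m" if "0 < m" "m < p" for m
    using that by (auto dest: dvd_imp_le)
  have p6: "p mod 6 = 1 \<or> p mod 6 = 5"
  proof -
    have "\<not> 2 dvd p" "\<not> 3 dvd p"
      using primes_dvd_imp_eq[of 2 p] primes_dvd_imp_eq[of 3 p] p by auto
    then show ?thesis by presburger
  qed
  have H_odd: "?H (int m)" if "odd m" "m < p" "\<not> 3 dvd m" for m
    using that IH[of m] by (intro odd_wild_residueI) (auto intro: Nat.gr0I)
  have H2: "?H 2"
  proof -
    \<comment> \<open>Since \<open>c\<close> is \<open>-p\<close> modulo 6, so is \<open>u\<close>,
      and \<open>p + 2 * u\<close> is again \<open>-p\<close>, hence prime to 6. The multiple of 6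
      added to \<open>c\<close> makes 5 divide \<open>p + 2 * u\<close>.\<close>
    define c where "c = (if p mod 6 = 5 then 1 else 5 :: nat)"
    define u where "u = c + 6 * ((2 * (p + 2 * c)) mod 5)"
    have "5 dvd t + 12 * ((2 * t) mod 5)" for t :: nat
    proof -
      have "(t + 12 * ((2 * t) mod 5)) mod 5 = (t + 12 * (2 * t)) mod 5"
        by (metis mod_add_right_eq mod_mult_right_eq)
      also have "\<dots> = 0" by presburger
      finally show ?thesis by (simp add: dvd_eq_mod_eq_0)
    qed
    from this[of "p + 2 * c"] have "5 dvd p + 2 * u" unfolding u_def by (simp add: algebra_simps)
    then obtain s where us: "p + 2 * u = 5 * s" by (elim dvdE)
    have "c \<le> 5" "(2 * (p + 2 * c)) mod 5 \<le> 4" unfolding c_def by auto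
    \<comment> \<open>The extreme value is 5 + 6 * 4. With \<open>p > 29\<close> it gives
      \<open>u < p\<close>, so \<open>u\<close> can be cancelled from \<open>5 * s\<close>, which is
      \<open>2 * u\<close> modulo \<open>p\<close>.\<close>
    then have u29: "u \<le> 29" unfolding u_def by linarith
    have "u mod 6 = c mod 6" unfolding u_def by simp
    then have "p mod 6 = 1 \<and> u mod 6 = 5 \<or> p mod 6 = 5 \<and> u mod 6 = 1"
      using p6 unfolding c_def by auto
    then have u: "odd u" "\<not> 3 dvd u" and "odd (p + 2 * u)" "\<not> 3 dvd p + 2 * u"
      by presburger+
    then have s: "odd s" "\<not> 3 dvd s" unfolding us by auto
    have "s < p" using us u29 p(2) by linarith
    then have "?H (5 * int s)"
      using odd_wild_residue_mult[OF H_odd[of 5] H_odd[of s]] p(2) s by simp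
    moreover have "[5 * int s = int u * 2] (mod int p)"
    proof -
      have "5 * int s = int u * 2 + int p" using us by linarith
      then show ?thesis by (simp add: cong_def)
    qed
    ultimately have "?H (int u * 2)" by (rule odd_wild_residue_cong)
    moreover have "0 < u" using u(1) by (auto intro: Nat.gr0I)
    ultimately show ?thesis
      using cancel[of "int u" 2] H_odd[of u] not_dvd[of u] u u29 p(2) by auto
  qed
  \<comment> \<open>Once 2 is available, splitting off factors 2 removes the parity
    condition.\<close>
  have H: "?H (int m)" if "0 < m" "m < p" "\<not> 3 dvd m" for m
    using that
  proof (induction m rule: less_induct)
    case (less m)
    show ?case
    proof (cases "odd m")
      case False
      then obtain k where k: "m = 2 * k" by (auto elim: evenE)
      then have "\<not> 3 dvd k" using less.prems(3) by (metis dvd_mult)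
      then have "?H (int k)" using less.IH[of k] less.prems k by simp
      then show ?thesis using odd_wild_residue_mult[OF H2] k by simp
    qed (use less H_odd in auto)
  qed
  have diff: "?H y" if "?H x" "x = y + int p * k" for x y k
    using that odd_wild_residue_cong[of p x y] by (simp add: cong_def)
  \<comment> \<open>One of \<open>p - 1\<close> and \<open>p - 2\<close> is prime to 3; in the
    second case 2 is cancelled from -2.\<close>
  have Hm1: "?H (-1)"
  proof (cases "p mod 3 = 2")
    case True
    then have "\<not> 3 dvd p - 1" by presburger
    then show ?thesis
      using diff[of "int (p - 1)" "-1" 1] H[of "p - 1"] p(2) by (simp add: of_nat_diff)
  next
    case False
    then have "\<not> 3 dvd p - 2" using p6 p(2) by presburger
    then have "?H (2 * (-1))"
      using diff[of "int (p - 2)" "-2" 1] H[of "p - 2"] p(2) by (simp add: of_nat_diff)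
    then show ?thesis using cancel[of 2 "-1"] H2 not_dvd[of 2] p(2) by simp
  qed
  have H3: "?H 3"
  proof -
    have three: "?H 3" if "0 < s" "s < p" "\<not> 3 dvd s" "?H r" "int s * 3 = r + int p * k" for s r k
    proof -
      have "?H (int s * 3)"
        using that(4,5) odd_wild_residue_cong[of p r "int s * 3"] by (simp add: cong_def)
      then show ?thesis using cancel[of "int s" 3] H[of s] not_dvd[of s] that by blast
    qed
    have H1: "?H 1" using H[of 1] p(2) by simp
    have Hm2: "?H (-2)" using odd_wild_residue_mult[OF Hm1 H2] by simp
    \<comment> \<open>The class modulo 9 decides which of \<open>2 * p + 1\<close>,
      \<open>p + 1\<close>, \<open>p - 1\<close>, \<open>p - 2\<close> is \<open>3 * s\<close> with
      \<open>s\<close> prime to 3; cancelling \<open>s\<close> leaves 3.\<close>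
    have "p mod 9 = 1 \<or> p mod 9 \<in> {2, 5} \<or> p mod 9 \<in> {4, 7} \<or> p mod 9 = 8"
      using p6 by simp presburger
    then consider "p mod 9 = 1" | "p mod 9 \<in> {2, 5}" | "p mod 9 \<in> {4, 7}" | "p mod 9 = 8" by blast
    then show ?thesis
    proof cases
      case 1
      then obtain q where "p = 9 * q + 1" by (metis mult_div_mod_eq)
      then show ?thesis using p(2) by (intro three[of "6 * q + 1" 1 2] H1) presburger+
    next
      case 2
      then have "\<exists>s. p + 1 = 3 * s \<and> \<not> 3 dvd s" by simp presburger
      then obtain s where "p + 1 = 3 * s" "\<not> 3 dvd s" by blast
      then show ?thesis using p(2) by (intro three[of s 1 1] H1) auto
    next
      case 3
      then have "\<exists>s. p = 3 * s + 1 \<and> \<not> 3 dvd s" by simp presburger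
      then obtain s where "p = 3 * s + 1" "\<not> 3 dvd s" by blast
      then show ?thesis using p(2) by (intro three[of s "-1" 1] Hm1) auto
    next
      case 4
      then have "\<exists>s. p = 3 * s + 2 \<and> \<not> 3 dvd s" by presburger
      then obtain s where "p = 3 * s + 2" "\<not> 3 dvd s" by blast
      then show ?thesis using p(2) by (intro three[of s "-2" 1] Hm2) auto
    qed
  qed
  \<comment> \<open>Either \<open>p\<close> or \<open>2 * p\<close> is 1 modulo 3.\<close>
  have "\<exists>w k. 3 * w + 1 = int p * k"
  proof (cases "p mod 3 = 1")
    case True
    then have "3 * (int p div 3) + 1 = int p * 1" by presburger
    then show ?thesis by blast
  next
    case False
    then have "3 * ((2 * int p - 1) div 3) + 1 = int p * 2" using p6 by presburger
    then show ?thesis by blast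
  qed
  then obtain w k where w: "3 * w + 1 = int p * k" by blast
  then have "-1 = 3 * w + int p * (- k)" by simp
  then have "?H (3 * w)" by (rule diff[OF Hm1])
  then have "?H w" using cancel[of 3 w] H3 not_dvd[of 3] p(2) by simp
  then show ?thesis using w by (metis dvd_triv_left)
qed

section \<open>Integers prime to 3 and the description of the semigroup\<close>

lemma nat_in_wild_semigroup:
  assumes conj: "weak_3x_plus_1_conjecture"
  shows "0 < m \<Longrightarrow> \<not> 3 dvd m \<Longrightarrow> of_nat m \<in> wild_semigroup"
proof (induction m rule: less_induct)
  case (less m)
  consider "m = 1" | "prime m" "m \<le> 29" | "prime m" "m > 29" | "m > 1" "\<not> prime m"
    using less.prems by linarith
  then show ?case
  proof cases
    case 1
    then show ?thesis using one_in_wild_semigroup by simp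
  next
    case 2
    then show ?thesis using small_primes_in_wild_semigroup[OF conj] less.prems(2) by (metis dvd_refl)
  next
    case 3
    then obtain w where "odd_wild_residue m w" "int m dvd 3 * w + 1"
      using odd_wild_residue_minus_third[of m] less.IH by blast
    then obtain N where N: "odd N" "of_nat N \<in> wild_semigroup" "[int N = w] (mod int m)"
      unfolding odd_wild_residue_def by blast
    have "[3 * int N + 1 = 3 * w + 1] (mod int m)"
      using N(3) by (intro cong_add cong_mult) auto
    then have "int m dvd int (3 * N + 1)"
      using \<open>int m dvd 3 * w + 1\<close> by (simp add: cong_dvd_iff add.commute)
    then have "m dvd 3 * N + 1" by (simp only: of_nat_dvd_iff)
    moreover have "odd m" using 3 prime_odd_nat by simp
    ultimately show ?thesis using in_wild_semigroup_if_dvd[OF conj N(1,2)] by blast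
  next
    case 4
    then obtain d where "d dvd m" "d \<noteq> 1" "d \<noteq> m" by (auto simp: prime_nat_iff)
    then obtain e where de: "m = d * e" by (elim dvdE)
    have "d \<noteq> 0" "e \<noteq> 0" "e \<noteq> 1" using de 4 \<open>d \<noteq> m\<close> by auto
    then have "1 < d" "1 < e" using \<open>d \<noteq> 1\<close> by linarith+
    then have "0 < d" "0 < e" "d < m" "e < m" using de by auto
    moreover have "\<not> 3 dvd d" "\<not> 3 dvd e" using less.prems de by auto
    ultimately show ?thesis using less.IH[of d] less.IH[of e] de
      by (simp add: wild_semigroup_mult)
  qed
qed

text \<open>The numerators \<open>3 * n + 2\<close> and 1 are prime to 3, and 3 is prime. Fractions
  need not be reduced here, so products are immediate.\<close>

lemma wild_semigroup_numerator:
  assumes "x \<in> wild_semigroup"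
  shows "\<exists>a b. x = of_nat a / of_nat b \<and> 0 < b \<and> \<not> 3 dvd a"
  using assms unfolding wild_semigroup_def
proof (induction rule: mult_semigroup.induct)
  case (generator x)
  then consider n where "x = wild_gen n" | "x = 1/2" by blast
  then show ?case
  proof cases
    case (1 n)
    have "x = of_nat (3 * n + 2) / of_nat (2 * n + 1)" using 1 by (simp add: wild_gen_def add.commute)
    moreover have "\<not> 3 dvd 3 * n + 2" by presburger
    ultimately show ?thesis by (metis add_gr_0 zero_less_one)
  next
    case 2
    then show ?thesis by (intro exI[of _ 1] exI[of _ 2]) simp
  qed
next
  case (product x y)
  then obtain a b c d where "x = of_nat a / of_nat b" "0 < b" "\<not> 3 dvd a"
      "y = of_nat c / of_nat d" "0 < d" "\<not> 3 dvd c" by blast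
  then have "x * y = of_nat (a * c) / of_nat (b * d)" "0 < b * d" "\<not> 3 dvd a * c"
    by (auto simp: prime_dvd_mult_iff)
  then show ?case by blast
qed

theorem theorem3p5:
  assumes "weak_3x_plus_1_conjecture"
  shows "wild_semigroup =
    {of_nat a / of_nat b | a b :: nat. a > 0 \<and> b > 0 \<and> coprime a b \<and> gcd a (3 * b) = 1}"
proof (intro equalityI subsetI)
  fix x :: rat
  assume "x \<in> wild_semigroup"
  then obtain a b where x: "x = of_nat a / of_nat b" "0 < b" "\<not> 3 dvd a"
    using wild_semigroup_numerator by blast
  have "gcd a b > 0" using x(2) by simp
  obtain a' b' where ab: "a = a' * gcd a b" "b = b' * gcd a b" "coprime a' b'"
    using gcd_coprime_exists[of a b] x(2) by auto
  have "x = of_nat a' / of_nat b'"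
    using \<open>gcd a b > 0\<close>
    by (subst x(1), subst ab(1), subst ab(2)) simp
  moreover have "\<not> 3 dvd a'" using x(3) ab(1) by (metis dvd_mult2)
  moreover from this have "a' > 0" by (auto intro: Nat.gr0I)
  moreover have "b' > 0" using ab(2) x(2) by (auto intro: Nat.gr0I)
  moreover have "gcd a' (3 * b') = 1"
    using \<open>\<not> 3 dvd a'\<close> prime_imp_coprime[of 3 a'] ab(3)
    by (intro coprime_imp_gcd_eq_1) (simp add: coprime_commute)
  ultimately show
    "x \<in> {of_nat a / of_nat b | a b :: nat. a > 0 \<and> b > 0 \<and> coprime a b \<and> gcd a (3 * b) = 1}"
    using ab(3) unfolding mem_Collect_eq by (intro exI[of _ a'] exI[of _ b'] conjI)
next
  fix x :: rat
  assume "x \<in> {of_nat a / of_nat b | a b :: nat. a > 0 \<and> b > 0 \<and> coprime a b \<and> gcd a (3 * b) = 1}"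
  then obtain a b where ab: "x = of_nat a / of_nat b" "a > 0" "b > 0" "gcd a (3 * b) = 1"
    unfolding mem_Collect_eq by (elim exE conjE) (rule that)
  have "\<not> 3 dvd a"
  proof
    assume "3 dvd a"
    then have "3 dvd gcd a (3 * b)" by simp
    then show False using ab(4) by simp
  qed
  \<comment> \<open>Here 3 may divide \<open>b\<close>: the conjecture supplies \<open>1 / b\<close>
    for every positive \<open>b\<close>.\<close>
  then have "of_nat a * (1 / of_nat b) \<in> wild_semigroup"
    using nat_in_wild_semigroup[OF assms] unit_fraction_in_wild_semigroup[OF assms] ab
    by (intro wild_semigroup_mult) auto
  then show "x \<in> wild_semigroup" using ab(1) by simp
qed

end
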